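(* Let $N$ be a normal subgroup of $G$ and let $e\in E^2(G,L;H)$. Then $N\leq H$ if and only if there exists $\varepsilon\in E^2(G/N,L^N)$ such that $e=\widehat{\varepsilon}$, that is, $e(\sigma,\tau)=\varepsilon(\sigma N,\tau N)$ for all $\sigma,\tau\in G$. In this case $$H_{G/N}(\varepsilon)=H_G(\widehat{\varepsilon})/N=H/N.$$
   Context: Standing assumptions: $R$ is a complete discrete valuation ring with quotient field $K$, and $L$ is a finite Galois extension of $K$ with Galois group $G$; the extension $L/K$ is unramified with finite residue field. For $\sigma\in G$ and $l\in L$ write $l^\sigma=\sigma(l)$. A (normalized) weak $2$-cocycle of $G$ on $L$ is a function $f:G\times G\to L$ with $f(\sigma,\tau)f(\sigma\tau,\rho)=f(\tau,\rho)^{\sigma}f(\sigma,\tau\rho)$ for all $\sigma,\tau,\rho\in G$ and $f(1,\sigma)=f(\sigma,1)=1$ for all $\sigma\in G$. It is called idempotent if all its values lie in $\{0,1\}$. $E^2(G,L)$ denotes the set of idempotent (normalized weak) $2$-cocycles of $G$ on $L$. The inertial group of $f$ is $H_G(f)=\{\sigma\in G: f(\sigma,\sigma^{-1})\neq 0\}$, which is known to be a subgroup of $G$. $E^2(G,L;H)$ denotes the set of idempotent $2$-cocycles of $G$ on $L$ with inertial group $H$. For a normal subgroup $N$ of $G$, $L^N$ is the fixed field of $N$, on which $G/N$ acts; $E^2(G/N,L^N)$ and $H_{G/N}$ are defined in the same way for the group $G/N$ acting on $L^N$. For a weak $2$-cocycle $g$ of $G/N$ on $L^N$, its inflation $\widehat{g}$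 is the weak $2$-cocycle of $G$ on $L$ given by $\widehat{g}(\sigma,\tau)=g(\sigma N,\tau N)$. *)

theory Defs
  imports "HOL-Algebra.Algebra"
begin

section \<open>Complete discrete valuation rings\<close>

text \<open>A discrete valuation ring is a principal ideal domain with exactly one nonzero prime ideal.\<close>

definition discrete_valuation_ring :: "('a, 'b) ring_scheme \<Rightarrow> bool" where
  "discrete_valuation_ring A \<longleftrightarrow>
     principal_domain A \<and> (\<exists>!P. primeideal P A \<and> P \<noteq> {\<zero>\<^bsub>A\<^esub>})"

definition max_ideal :: "('a, 'b) ring_scheme \<Rightarrow> 'a set" where
  "max_ideal A = (THE M. maximalideal M A)"

text \<open>Every Cauchy sequence for the topology given by the powers of the maximal ideal converges.
  Powers of ideals are taken in the library's multiplicative monoid of ideals. Separatedness need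
  not be demanded: it is automatic for a discrete valuation ring.\<close>

definition adically_complete :: "('a, 'b) ring_scheme \<Rightarrow> bool" where
  "adically_complete A \<longleftrightarrow>
     (\<forall>x :: nat \<Rightarrow> 'a. range x \<subseteq> carrier A \<longrightarrow>
        (\<forall>n :: nat. \<exists>k. \<forall>i\<ge>k. \<forall>j\<ge>k. x i \<ominus>\<^bsub>A\<^esub> x j \<in> max_ideal A [^]\<^bsub>ideals_set A\<^esub> n) \<longrightarrow>
        (\<exists>l\<in>carrier A. \<forall>n :: nat. \<exists>k. \<forall>i\<ge>k. x i \<ominus>\<^bsub>A\<^esub> l \<in> max_ideal A [^]\<^bsub>ideals_set A\<^esub> n))"

definition complete_dvr :: "('a, 'b) ring_scheme \<Rightarrow> bool" where
  "complete_dvr A \<longleftrightarrow> discrete_valuation_ring A \<and> adically_complete A"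

definition residue_field :: "('a, 'b) ring_scheme \<Rightarrow> 'a set ring" where
  "residue_field A = A Quot (max_ideal A)"

definition quotient_field_in :: "('a, 'b) ring_scheme \<Rightarrow> 'a set \<Rightarrow> 'a set" where
  "quotient_field_in L R = {a \<otimes>\<^bsub>L\<^esub> inv\<^bsub>L\<^esub> b | a b. a \<in> R \<and> b \<in> R - {\<zero>\<^bsub>L\<^esub>}}"

definition integral_closure :: "('a, 'b) ring_scheme \<Rightarrow> 'a set \<Rightarrow> 'a set" where
  "integral_closure L R =
     {x \<in> carrier L. \<exists>p \<in> carrier (univ_poly L R).
        p \<noteq> [] \<and> lead_coeff p = \<one>\<^bsub>L\<^esub> \<and> ring.eval L p x = \<zero>\<^bsub>L\<^esub>}"

section \<open>Separable and Galois extensions\<close>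

text \<open>Polynomials are lists of coefficients with the leading one first, so the entry at position
  \<open>i\<close> belongs to the exponent \<open>degree p - i\<close>.\<close>

definition poly_deriv :: "('a, 'b) ring_scheme \<Rightarrow> 'a list \<Rightarrow> 'a list" where
  "poly_deriv F p =
     ring.normalize F (map (\<lambda>i. add_pow F (degree p - i) (p ! i)) [0..<degree p])"

definition separable_poly :: "('a, 'b) ring_scheme \<Rightarrow> 'a set \<Rightarrow> 'a list \<Rightarrow> bool" where
  "separable_poly F k p \<longleftrightarrow>
     (\<forall>d \<in> carrier (univ_poly F k).
        d divides\<^bsub>univ_poly F k\<^esub> p \<and> d divides\<^bsub>univ_poly F k\<^esub> poly_deriv F p \<longrightarrow>
        d \<in> Units (univ_poly F k))"

definition separable_extension :: "('a, 'b) ring_scheme \<Rightarrow> 'a set \<Rightarrow> bool" where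
  "separable_extension F k \<longleftrightarrow>
     (\<forall>x \<in> carrier F. \<not> ring.transcendental F k x \<and> separable_poly F k (ring.Irr F k x))"

text \<open>The maps are extensional, as elements of \<^term>\<open>BijGroup (carrier L)\<close>; the product of
  \<open>\<sigma>\<close> and \<open>\<tau>\<close> is \<open>\<sigma> \<circ> \<tau>\<close>.\<close>

definition galois_group :: "('a, 'b) ring_scheme \<Rightarrow> 'a set \<Rightarrow> ('a \<Rightarrow> 'a) monoid" where
  "galois_group L K =
     (BijGroup (carrier L))
       \<lparr>carrier := {\<sigma> \<in> Bij (carrier L). \<sigma> \<in> ring_hom L L \<and> (\<forall>x\<in>K. \<sigma> x = x)}\<rparr>"

definition fixed_field :: "('a, 'b) ring_scheme \<Rightarrow> ('a \<Rightarrow> 'a) set \<Rightarrow> 'a set" where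
  "fixed_field L N = {x \<in> carrier L. \<forall>\<sigma>\<in>N. \<sigma> x = x}"

definition finite_galois_extension :: "('a, 'b) ring_scheme \<Rightarrow> 'a set \<Rightarrow> bool" where
  "finite_galois_extension L K \<longleftrightarrow>
     field L \<and> subfield K L \<and> ring.finite_dimension L K (carrier L) \<and>
     fixed_field L (carrier (galois_group L K)) = K"

section \<open>Unramified extensions\<close>

text \<open>Let \<open>S\<close> be the integral closure of \<open>R\<close> in \<open>L\<close>. Ramification index one means that the maximal
  ideal of \<open>R\<close> generates the maximal ideal of \<open>S\<close>. The residue field of \<open>R\<close> is regarded as a
  subfield of that of \<open>S\<close>, namely as the image of \<open>R\<close>.\<close>

definition unramified_extension :: "('a, 'b) ring_scheme \<Rightarrow> 'a set \<Rightarrow> bool" where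
  "unramified_extension L R \<longleftrightarrow>
     (let S = L\<lparr>carrier := integral_closure L R\<rparr>;
          P = Idl\<^bsub>S\<^esub> (max_ideal (L\<lparr>carrier := R\<rparr>))
      in maximalideal P S \<and>
         separable_extension (S Quot P) ((\<lambda>r. P +>\<^bsub>S\<^esub> r) ` R))"

section \<open>Weak 2-cocycles\<close>

text \<open>Here \<open>act \<sigma> x\<close> is the action of \<open>\<sigma> \<in> G\<close> on \<open>x \<in> F\<close>. Functions on \<open>G \<times> G\<close> are extensional,
  so that equality of cocycles is equality of all values on \<open>G \<times> G\<close>.\<close>

definition weak_2_cocycles ::
    "('g, 'c) monoid_scheme \<Rightarrow> ('g \<Rightarrow> 'a \<Rightarrow> 'a) \<Rightarrow> ('a, 'b) ring_scheme \<Rightarrow> ('g \<times> 'g \<Rightarrow> 'a) set" where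
  "weak_2_cocycles G act F =
     {f \<in> carrier G \<times> carrier G \<rightarrow>\<^sub>E carrier F.
        (\<forall>\<sigma>\<in>carrier G. \<forall>\<tau>\<in>carrier G. \<forall>\<rho>\<in>carrier G.
           f (\<sigma>, \<tau>) \<otimes>\<^bsub>F\<^esub> f (\<sigma> \<otimes>\<^bsub>G\<^esub> \<tau>, \<rho>) = act \<sigma> (f (\<tau>, \<rho>)) \<otimes>\<^bsub>F\<^esub> f (\<sigma>, \<tau> \<otimes>\<^bsub>G\<^esub> \<rho>)) \<and>
        (\<forall>\<sigma>\<in>carrier G. f (\<one>\<^bsub>G\<^esub>, \<sigma>) = \<one>\<^bsub>F\<^esub> \<and> f (\<sigma>, \<one>\<^bsub>G\<^esub>) = \<one>\<^bsub>F\<^esub>)}"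

definition idempotent_2_cocycles ::
    "('g, 'c) monoid_scheme \<Rightarrow> ('g \<Rightarrow> 'a \<Rightarrow> 'a) \<Rightarrow> ('a, 'b) ring_scheme \<Rightarrow> ('g \<times> 'g \<Rightarrow> 'a) set" where
  "idempotent_2_cocycles G act F =
     {f \<in> weak_2_cocycles G act F.
        \<forall>\<sigma>\<in>carrier G. \<forall>\<tau>\<in>carrier G. f (\<sigma>, \<tau>) \<in> {\<zero>\<^bsub>F\<^esub>, \<one>\<^bsub>F\<^esub>}}"

definition inertial_group ::
    "('g, 'c) monoid_scheme \<Rightarrow> ('a, 'b) ring_scheme \<Rightarrow> ('g \<times> 'g \<Rightarrow> 'a) \<Rightarrow> 'g set" where
  "inertial_group G F f = {\<sigma> \<in> carrier G. f (\<sigma>, inv\<^bsub>G\<^esub> \<sigma>) \<noteq> \<zero>\<^bsub>F\<^esub>}"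

definition idempotent_2_cocycles_inertial ::
    "('g, 'c) monoid_scheme \<Rightarrow> ('g \<Rightarrow> 'a \<Rightarrow> 'a) \<Rightarrow> ('a, 'b) ring_scheme \<Rightarrow> 'g set
      \<Rightarrow> ('g \<times> 'g \<Rightarrow> 'a) set" where
  "idempotent_2_cocycles_inertial G act F H =
     {f \<in> idempotent_2_cocycles G act F. inertial_group G F f = H}"

text \<open>A coset \<open>C\<close> of \<open>N\<close> acts on an element fixed by \<open>N\<close> through the common value of its
  members.\<close>

definition coset_action :: "('a \<Rightarrow> 'a) set \<Rightarrow> 'a \<Rightarrow> 'a" where
  "coset_action C x = (THE y. \<forall>\<sigma>\<in>C. \<sigma> x = y)"

definition inflation ::
    "('g, 'c) monoid_scheme \<Rightarrow> 'g set \<Rightarrow> ('g set \<times> 'g set \<Rightarrow> 'a) \<Rightarrow> ('g \<times> 'g \<Rightarrow> 'a)" where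
  "inflation G N g =
     restrict (\<lambda>(\<sigma>, \<tau>). g (\<sigma> <#\<^bsub>G\<^esub> N, \<tau> <#\<^bsub>G\<^esub> N)) (carrier G \<times> carrier G)"

end

theory Submission
  imports Defs
begin

text \<open>An idempotent cocycle is a relation on \<open>G\<close>, since the action fixes 0 and 1. If \<open>N\<close> lies in the
  inertial group, then \<open>e (n, n\<inverse>) = 1\<close> together with the cocycle identity at \<open>(n, n\<inverse>, \<rho>)\<close> and at
  \<open>(\<sigma>, n, n\<inverse>)\<close> forces \<open>e (n, \<rho>) = 1 = e (\<sigma>, n)\<close>. The identities at \<open>(n, \<sigma>, \<tau>)\<close> and \<open>(\<sigma>, \<tau>, n)\<close>
  then show that \<open>e\<close> does not change when its first argument is multiplied on the left, or its second
  one on the right, by \<open>n\<close>. As \<open>N\<close> is normal, \<open>e\<close> descends to \<open>G/N\<close>.\<close>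

section \<open>Actions on 0 and 1\<close>

lemma galois_group_fixes_zero_one:
  assumes "ring L" and "\<sigma> \<in> carrier (galois_group L K)"
  shows "\<sigma> \<zero>\<^bsub>L\<^esub> = \<zero>\<^bsub>L\<^esub>" and "\<sigma> \<one>\<^bsub>L\<^esub> = \<one>\<^bsub>L\<^esub>"
proof -
  have "\<sigma> \<in> ring_hom L L"
    using assms(2) by (simp add: galois_group_def)
  then show "\<sigma> \<zero>\<^bsub>L\<^esub> = \<zero>\<^bsub>L\<^esub>" and "\<sigma> \<one>\<^bsub>L\<^esub> = \<one>\<^bsub>L\<^esub>"
    using assms(1) by (auto intro: ring_hom_zero ring_hom_one)
qed

text \<open>A member of \<open>C\<close> pins down the common value; this uniqueness is what makes
  the definite description in \<open>coset_action\<close> usable.\<close>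

lemma coset_action_eqI:
  assumes "C \<noteq> {}" and "\<And>\<sigma>. \<sigma> \<in> C \<Longrightarrow> \<sigma> x = y"
  shows "coset_action C x = y"
  unfolding coset_action_def using assms by (intro the_equality) auto

text \<open>The values of an idempotent cocycle are 0 and 1, so an action affects the cocycle
  identity only through its effect on these two elements. This allows the argument to run over any
  group and any domain.\<close>

locale idempotent_cocycle = G: group G + F: domain F
  for G :: "('g, 'c) monoid_scheme" (structure)
    and F :: "('a, 'b) ring_scheme" +
  fixes act :: "'g \<Rightarrow> 'a \<Rightarrow> 'a" and e :: "'g \<times> 'g \<Rightarrow> 'a"
  assumes cocycle: "e \<in> idempotent_2_cocycles G act F"
    and act_zero: "\<sigma> \<in> carrier G \<Longrightarrow> act \<sigma> \<zero>\<^bsub>F\<^esub> = \<zero>\<^bsub>F\<^esub>"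
    and act_one: "\<sigma> \<in> carrier G \<Longrightarrow> act \<sigma> \<one>\<^bsub>F\<^esub> = \<one>\<^bsub>F\<^esub>"
begin

lemma value_cases:
  assumes "\<sigma> \<in> carrier G" "\<tau> \<in> carrier G"
  obtains "e (\<sigma>, \<tau>) = \<zero>\<^bsub>F\<^esub>" | "e (\<sigma>, \<tau>) = \<one>\<^bsub>F\<^esub>"
  using cocycle assms unfolding idempotent_2_cocycles_def by blast

lemma one_left: "\<sigma> \<in> carrier G \<Longrightarrow> e (\<one>, \<sigma>) = \<one>\<^bsub>F\<^esub>"
  and one_right: "\<sigma> \<in> carrier G \<Longrightarrow> e (\<sigma>, \<one>) = \<one>\<^bsub>F\<^esub>"
  using cocycle unfolding idempotent_2_cocycles_def weak_2_cocycles_def by auto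

lemma act_value:
  assumes "\<sigma> \<in> carrier G" "\<tau> \<in> carrier G" "\<rho> \<in> carrier G"
  shows "act \<sigma> (e (\<tau>, \<rho>)) = e (\<tau>, \<rho>)"
  using assms value_cases[of \<tau> \<rho>] act_zero act_one by metis

lemma cocycle_identity:
  assumes "\<sigma> \<in> carrier G" "\<tau> \<in> carrier G" "\<rho> \<in> carrier G"
  shows "e (\<sigma>, \<tau>) \<otimes>\<^bsub>F\<^esub> e (\<sigma> \<otimes> \<tau>, \<rho>) = e (\<tau>, \<rho>) \<otimes>\<^bsub>F\<^esub> e (\<sigma>, \<tau> \<otimes> \<rho>)"
proof -
  have "e (\<sigma>, \<tau>) \<otimes>\<^bsub>F\<^esub> e (\<sigma> \<otimes> \<tau>, \<rho>) = act \<sigma> (e (\<tau>, \<rho>)) \<otimes>\<^bsub>F\<^esub> e (\<sigma>, \<tau> \<otimes> \<rho>)"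
    using cocycle assms unfolding idempotent_2_cocycles_def weak_2_cocycles_def by blast
  then show ?thesis
    using assms by (simp add: act_value)
qed

lemma value_closed:
  assumes "\<sigma> \<in> carrier G" "\<tau> \<in> carrier G"
  shows "e (\<sigma>, \<tau>) \<in> carrier F"
  using assms by (cases rule: value_cases[of \<sigma> \<tau>]) simp_all

text \<open>A first factor 0 would make the product 0, and 0 differs from 1 in a domain.\<close>

lemma mult_eq_one:
  assumes "\<sigma> \<in> carrier G" "\<tau> \<in> carrier G" "\<sigma>' \<in> carrier G" "\<tau>' \<in> carrier G"
    and "e (\<sigma>, \<tau>) \<otimes>\<^bsub>F\<^esub> e (\<sigma>', \<tau>') = \<one>\<^bsub>F\<^esub>"
  shows "e (\<sigma>, \<tau>) = \<one>\<^bsub>F\<^esub>"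
  using assms
  by (cases rule: value_cases[of \<sigma> \<tau>]) (auto simp: value_closed)

lemma inertial_value:
  assumes "\<sigma> \<in> inertial_group G F e"
  shows "e (\<sigma>, inv \<sigma>) = \<one>\<^bsub>F\<^esub>"
  using assms value_cases[of \<sigma> "inv \<sigma>"] unfolding inertial_group_def by auto

section \<open>Invariance under the inertial group\<close>

lemma inertial_right:
  assumes "\<sigma> \<in> inertial_group G F e" "\<tau> \<in> carrier G"
  shows "e (\<tau>, \<sigma>) = \<one>\<^bsub>F\<^esub>"
proof -
  have [simp]: "\<sigma> \<in> carrier G"
    using assms(1) by (simp add: inertial_group_def)
  have "e (\<tau>, \<sigma>) \<otimes>\<^bsub>F\<^esub> e (\<tau> \<otimes> \<sigma>, inv \<sigma>) = \<one>\<^bsub>F\<^esub>"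
    using cocycle_identity[of \<tau> \<sigma> "inv \<sigma>"] assms by (simp add: inertial_value one_right)
  then show ?thesis
    using assms(2) by (intro mult_eq_one[of \<tau> \<sigma> "\<tau> \<otimes> \<sigma>" "inv \<sigma>"]) simp_all
qed

text \<open>The identity at \<open>(\<sigma>, inv \<sigma>, \<rho>)\<close> has left side 1, and the
  first factor on its right side is the value at \<open>(inv \<sigma>, \<rho>)\<close>. Hence the
  inverse is treated first; \<open>inertial_left\<close> follows once the inertial group is known to
  be closed under inverses.\<close>

lemma inertial_left_inv:
  assumes "\<sigma> \<in> inertial_group G F e" "\<rho> \<in> carrier G"
  shows "e (inv \<sigma>, \<rho>) = \<one>\<^bsub>F\<^esub>"
proof -
  have [simp]: "\<sigma> \<in> carrier G"
    using assms(1) by (simp add: inertial_group_def)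
  have "e (inv \<sigma>, \<rho>) \<otimes>\<^bsub>F\<^esub> e (\<sigma>, inv \<sigma> \<otimes> \<rho>) = \<one>\<^bsub>F\<^esub>"
    using cocycle_identity[of \<sigma> "inv \<sigma>" \<rho>] assms by (simp add: inertial_value one_left)
  then show ?thesis
    using assms(2) by (intro mult_eq_one[of "inv \<sigma>" \<rho> \<sigma> "inv \<sigma> \<otimes> \<rho>"]) simp_all
qed

text \<open>Taking \<rho> = \<sigma> in the preceding lemma gives
  \<open>e (inv \<sigma>, \<sigma>) = 1\<close>, and \<sigma> is the inverse of
  \<open>inv \<sigma>\<close>.\<close>

lemma inertial_group_inv:
  assumes "\<sigma> \<in> inertial_group G F e"
  shows "inv \<sigma> \<in> inertial_group G F e"
  using assms inertial_left_inv[OF assms, of \<sigma>] by (auto simp: inertial_group_def)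

lemma inertial_left:
  assumes "\<sigma> \<in> inertial_group G F e" "\<rho> \<in> carrier G"
  shows "e (\<sigma>, \<rho>) = \<one>\<^bsub>F\<^esub>"
  using inertial_left_inv[OF inertial_group_inv[OF assms(1)] assms(2)] assms(1)
  by (simp add: inertial_group_def)

lemma inertial_mult_left:
  assumes "\<eta> \<in> inertial_group G F e" "\<sigma> \<in> carrier G" "\<tau> \<in> carrier G"
  shows "e (\<eta> \<otimes> \<sigma>, \<tau>) = e (\<sigma>, \<tau>)"
proof -
  have "\<eta> \<in> carrier G"
    using assms(1) by (simp add: inertial_group_def)
  then show ?thesis
    using cocycle_identity[of \<eta> \<sigma> \<tau>] assms by (simp add: inertial_left value_closed)
qed

lemma inertial_mult_right:
  assumes "\<eta> \<in> inertial_group G F e" "\<sigma> \<in> carrier G" "\<tau> \<in> carrier G"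
  shows "e (\<sigma>, \<tau> \<otimes> \<eta>) = e (\<sigma>, \<tau>)"
proof -
  have "\<eta> \<in> carrier G"
    using assms(1) by (simp add: inertial_group_def)
  then show ?thesis
    using cocycle_identity[of \<sigma> \<tau> \<eta>] assms by (simp add: inertial_right value_closed)
qed

lemma normal_coset_invariant:
  assumes "N \<lhd> G" and "N \<subseteq> inertial_group G F e"
    and "\<sigma> \<in> carrier G" "\<tau> \<in> carrier G"
    and "\<sigma>' \<in> \<sigma> <# N" "\<tau>' \<in> \<tau> <# N"
  shows "e (\<sigma>', \<tau>') = e (\<sigma>, \<tau>)"
proof -
  \<comment> \<open>Normality enters here: the first argument is invariant under multiplication on
    the left, so the left coset of \<sigma> must be read as the right coset
    \<open>N #> \<sigma>\<close>. The second argument needs no such exchange.\<close>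
  obtain n where n: "n \<in> N" "\<sigma>' = n \<otimes> \<sigma>"
    using assms(3,5) normal.coset_eq[OF assms(1)] by (auto simp: r_coset_def)
  obtain m where m: "m \<in> N" "\<tau>' = \<tau> \<otimes> m"
    using assms(6) by (auto simp: l_coset_def)
  have [simp]: "m \<in> carrier G"
    using m(1) assms(2) by (auto simp: inertial_group_def)
  have "e (\<sigma>', \<tau>') = e (\<sigma>, \<tau> \<otimes> m)"
    using inertial_mult_left[of n \<sigma> "\<tau> \<otimes> m"] n m(2) assms(2-4) by auto
  also have "\<dots> = e (\<sigma>, \<tau>)"
    using m(1) assms(2-4) by (auto intro!: inertial_mult_right)
  finally show ?thesis .
qed

text \<open>Any set \<open>S\<close> containing 0 and 1 can serve as the carrier, and any
  \<open>act'\<close> fixing both as the action, because the descended cocycle has no other values.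
  The theorem takes the fixed field of \<open>N\<close> and \<open>coset_action\<close>.\<close>

lemma descends_to_quotient:
  assumes N: "N \<lhd> G" and NH: "N \<subseteq> inertial_group G F e"
    and S: "\<zero>\<^bsub>F\<^esub> \<in> S" "\<one>\<^bsub>F\<^esub> \<in> S"
    and act': "\<And>C. C \<in> carrier (G Mod N) \<Longrightarrow> act' C \<zero>\<^bsub>F\<^esub> = \<zero>\<^bsub>F\<^esub>"
      "\<And>C. C \<in> carrier (G Mod N) \<Longrightarrow> act' C \<one>\<^bsub>F\<^esub> = \<one>\<^bsub>F\<^esub>"
  shows "\<exists>\<epsilon> \<in> idempotent_2_cocycles (G Mod N) act' (F\<lparr>carrier := S\<rparr>). e = inflation G N \<epsilon>"
proof -
  interpret N: normal N G by (rule N)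
  define rep where "rep C = (SOME \<sigma>. \<sigma> \<in> C)" for C :: "'g set"
  \<comment> \<open>The value on two cosets is that of \<open>e\<close> at chosen representatives;
    \<open>normal_coset_invariant\<close> makes the choice immaterial. The restriction makes
    \<epsilon> extensional, as cocycles are required to be.\<close>
  define \<epsilon> where "\<epsilon> = restrict (\<lambda>(A, B). e (rep A, rep B)) (carrier (G Mod N) \<times> carrier (G Mod N))"
  have coset: "\<sigma> <# N \<in> carrier (G Mod N)" if "\<sigma> \<in> carrier G" for \<sigma>
    using that N.coset_eq by (auto simp: FactGroup_def RCOSETS_def)
  have cosetE: "\<exists>\<sigma>\<in>carrier G. C = \<sigma> <# N" if "C \<in> carrier (G Mod N)" for C
    using that N.coset_eq by (auto simp: FactGroup_def RCOSETS_def)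
  have rep: "rep (\<sigma> <# N) \<in> \<sigma> <# N" if "\<sigma> \<in> carrier G" for \<sigma>
    unfolding rep_def by (rule someI[of _ \<sigma>]) (use that in \<open>force simp: l_coset_def\<close>)
  have \<epsilon>: "\<epsilon> (\<sigma> <# N, \<tau> <# N) = e (\<sigma>, \<tau>)" if "\<sigma> \<in> carrier G" "\<tau> \<in> carrier G" for \<sigma> \<tau>
    using normal_coset_invariant[OF N NH that rep rep] that by (simp add: \<epsilon>_def coset)
  have one: "\<one>\<^bsub>G Mod N\<^esub> = \<one> <# N"
    using N.coset_eq G.coset_mult_one[OF N.subset] by (simp flip: N.coset_eq[THEN bspec])
  have mult: "(\<sigma> <# N) \<otimes>\<^bsub>G Mod N\<^esub> (\<tau> <# N) = (\<sigma> \<otimes> \<tau>) <# N"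
    if "\<sigma> \<in> carrier G" "\<tau> \<in> carrier G" for \<sigma> \<tau>
    using that N.coset_eq N.rcos_sum by (simp add: FactGroup_def)
  have zero_or_one: "\<epsilon> (A, B) \<in> {\<zero>\<^bsub>F\<^esub>, \<one>\<^bsub>F\<^esub>}"
    if "A \<in> carrier (G Mod N)" "B \<in> carrier (G Mod N)" for A B
    using that[THEN cosetE] by (auto simp: \<epsilon> elim: value_cases)
  have act_\<epsilon>: "act' C (\<epsilon> (A, B)) = \<epsilon> (A, B)"
    if "A \<in> carrier (G Mod N)" "B \<in> carrier (G Mod N)" "C \<in> carrier (G Mod N)" for A B C
    using zero_or_one[OF that(1,2)] that(3) by (auto simp: act')
  have "\<epsilon> \<in> carrier (G Mod N) \<times> carrier (G Mod N) \<rightarrow>\<^sub>E S"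
  proof
    fix p assume "p \<in> carrier (G Mod N) \<times> carrier (G Mod N)"
    then show "\<epsilon> p \<in> S"
      using zero_or_one S by (cases p) fastforce
  qed (simp add: \<epsilon>_def)
  moreover have "\<epsilon> (A, B) \<otimes>\<^bsub>F\<^esub> \<epsilon> (A \<otimes>\<^bsub>G Mod N\<^esub> B, C) = act' A (\<epsilon> (B, C)) \<otimes>\<^bsub>F\<^esub> \<epsilon> (A, B \<otimes>\<^bsub>G Mod N\<^esub> C)"
    if ABC: "A \<in> carrier (G Mod N)" "B \<in> carrier (G Mod N)" "C \<in> carrier (G Mod N)" for A B C
  proof -
    \<comment> \<open>Lifting the three cosets to elements of \<open>G\<close> turns the claim into
      the identity for \<open>e\<close>, in which the action has already been removed;
      \<open>act_\<epsilon>\<close> removes \<open>act' A\<close> in the same way.\<close>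
    obtain \<sigma> \<tau> \<rho> where "\<sigma> \<in> carrier G" "\<tau> \<in> carrier G" "\<rho> \<in> carrier G"
      and "A = \<sigma> <# N" "B = \<tau> <# N" "C = \<rho> <# N"
      using ABC[THEN cosetE] by blast
    then show ?thesis
      using cocycle_identity[of \<sigma> \<tau> \<rho>] act_\<epsilon>[OF ABC(2,3,1)]
      by (simp add: \<epsilon> mult del: mult_FactGroup)
  qed
  moreover have "\<epsilon> (\<one>\<^bsub>G Mod N\<^esub>, A) = \<one>\<^bsub>F\<^esub>" "\<epsilon> (A, \<one>\<^bsub>G Mod N\<^esub>) = \<one>\<^bsub>F\<^esub>"
    if "A \<in> carrier (G Mod N)" for A
    using cosetE[OF that] by (auto simp del: one_FactGroup simp: \<epsilon> one one_left one_right)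
  ultimately have "\<epsilon> \<in> idempotent_2_cocycles (G Mod N) act' (F\<lparr>carrier := S\<rparr>)"
    using zero_or_one
    by (simp add: idempotent_2_cocycles_def weak_2_cocycles_def del: one_FactGroup mult_FactGroup)
  moreover have "e = inflation G N \<epsilon>"
  \<comment> \<open>Both sides are extensional, so it is enough to compare them on pairs of elements
    of \<open>G\<close>.\<close>
  proof (rule extensionalityI)
    show "e \<in> extensional (carrier G \<times> carrier G)"
      using cocycle by (auto simp: idempotent_2_cocycles_def weak_2_cocycles_def PiE_def)
    show "inflation G N \<epsilon> \<in> extensional (carrier G \<times> carrier G)"
      unfolding inflation_def by (rule restrict_extensional)
    show "e p = inflation G N \<epsilon> p" if "p \<in> carrier G \<times> carrier G" for p
      using that by (auto simp: inflation_def \<epsilon>)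
  qed
  ultimately show ?thesis by blast
qed

end

section \<open>Inertial groups of inflated cocycles\<close>

lemma normal_subset_inertial_group_inflation:
  assumes "N \<lhd> G" and "\<one>\<^bsub>F\<^esub> \<noteq> \<zero>\<^bsub>F\<^esub>" and "\<epsilon> \<in> idempotent_2_cocycles (G Mod N) act (F\<lparr>carrier := S\<rparr>)"
  shows "N \<subseteq> inertial_group G F (inflation G N \<epsilon>)"
proof
  interpret N: normal N G by (rule assms)
  fix n assume n: "n \<in> N"
  have "N \<in> carrier (G Mod N)"
    using N.factorgroup_is_group group.is_monoid monoid.one_closed by fastforce
  then have "\<epsilon> (N, N) = \<one>\<^bsub>F\<^esub>"
    using assms(3) by (auto simp: idempotent_2_cocycles_def weak_2_cocycles_def)
  \<comment> \<open>Applied to \<open>n\<close> and to its inverse, this makes the inflated value at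
    that pair equal to \<open>\<epsilon> (N, N)\<close>, which is 1 by normalization.\<close>
  moreover have "m <#\<^bsub>G\<^esub> N = N" if "m \<in> N" for m
    using that N.rcos_const[OF N.is_group] N.mem_carrier by (simp flip: N.coset_eq[THEN bspec])
  ultimately show "n \<in> inertial_group G F (inflation G N \<epsilon>)"
    using n assms(2) by (simp add: inertial_group_def inflation_def N.mem_carrier)
qed

text \<open>The inverse of the coset of \<sigma> is the coset of the inverse of \<sigma>, so the
  condition for a coset to be inertial for \<epsilon> is the condition for any of its
  representatives to be inertial for the inflation.\<close>

lemma inertial_group_inflation:
  assumes "N \<lhd> G"
  shows "inertial_group (G Mod N) (F\<lparr>carrier := S\<rparr>) \<epsilon>
    = carrier (G\<lparr>carrier := inertial_group G F (inflation G N \<epsilon>)\<rparr> Mod N)"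
proof -
  interpret N: normal N G by (rule assms)
  have coset: "N #>\<^bsub>G\<^esub> \<sigma> \<in> carrier (G Mod N)" if "\<sigma> \<in> carrier G" for \<sigma>
    using that by (auto simp: FactGroup_def RCOSETS_def)
  have nonzero: "\<epsilon> (N #>\<^bsub>G\<^esub> \<sigma>, inv\<^bsub>G Mod N\<^esub> (N #>\<^bsub>G\<^esub> \<sigma>)) \<noteq> \<zero>\<^bsub>F\<^esub>
      \<longleftrightarrow> \<sigma> \<in> inertial_group G F (inflation G N \<epsilon>)" if "\<sigma> \<in> carrier G" for \<sigma>
    using that by (simp add: inertial_group_def inflation_def N.inv_FactGroup coset N.rcos_inv
        N.coset_eq[THEN bspec, symmetric])
  have "inertial_group (G Mod N) (F\<lparr>carrier := S\<rparr>) \<epsilon>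
      = (\<lambda>\<sigma>. N #>\<^bsub>G\<^esub> \<sigma>) ` {\<sigma> \<in> carrier G.
          \<epsilon> (N #>\<^bsub>G\<^esub> \<sigma>, inv\<^bsub>G Mod N\<^esub> (N #>\<^bsub>G\<^esub> \<sigma>)) \<noteq> \<zero>\<^bsub>F\<^esub>}"
    unfolding inertial_group_def by (auto simp: FactGroup_def RCOSETS_def)
  also have "\<dots> = (\<lambda>\<sigma>. N #>\<^bsub>G\<^esub> \<sigma>) ` inertial_group G F (inflation G N \<epsilon>)"
    using nonzero by (intro image_cong) (auto simp: inertial_group_def)
  \<comment> \<open>Shrinking the carrier leaves the multiplication as it is, so the cosets of
    \<open>N\<close> by inertial elements are the same sets in either structure.\<close>
  also have "\<dots> = carrier (G\<lparr>carrier := inertial_group G F (inflation G N \<epsilon>)\<rparr> Mod N)"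
    by (auto simp: FactGroup_def RCOSETS_def r_coset_def)
  finally show ?thesis .
qed

theorem theorem5p3:
  fixes L :: "('a, 'b) ring_scheme"
    and K R :: "'a set"
    and G :: "('a \<Rightarrow> 'a) monoid"
    and N H :: "('a \<Rightarrow> 'a) set"
    and e :: "('a \<Rightarrow> 'a) \<times> ('a \<Rightarrow> 'a) \<Rightarrow> 'a"
  assumes "G = galois_group L K"
    and "finite_galois_extension L K"
    and "subring R L"
    and "complete_dvr (L\<lparr>carrier := R\<rparr>)"
    and "quotient_field_in L R = K"
    and "unramified_extension L R"
    and "finite (carrier (residue_field (L\<lparr>carrier := R\<rparr>)))"
    and "N \<lhd> G"
    and "e \<in> idempotent_2_cocycles_inertial G (\<lambda>\<sigma>. \<sigma>) L H"
  shows "(N \<subseteq> H \<longleftrightarrow>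
            (\<exists>\<epsilon> \<in> idempotent_2_cocycles (G Mod N) coset_action (L\<lparr>carrier := fixed_field L N\<rparr>).
               e = inflation G N \<epsilon>)) \<and>
         (\<forall>\<epsilon> \<in> idempotent_2_cocycles (G Mod N) coset_action (L\<lparr>carrier := fixed_field L N\<rparr>).
            e = inflation G N \<epsilon> \<longrightarrow>
              inertial_group (G Mod N) (L\<lparr>carrier := fixed_field L N\<rparr>) \<epsilon>
                = carrier (G\<lparr>carrier := inertial_group G L (inflation G N \<epsilon>)\<rparr> Mod N) \<and>
              carrier (G\<lparr>carrier := inertial_group G L (inflation G N \<epsilon>)\<rparr> Mod N)
                = carrier (G\<lparr>carrier := H\<rparr> Mod N))"
proof -
  interpret N: normal N G by (rule assms)
  interpret L: field L
    using assms(2) by (simp add: finite_galois_extension_def)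
  have e: "e \<in> idempotent_2_cocycles G (\<lambda>\<sigma>. \<sigma>) L" and H: "inertial_group G L e = H"
    using assms(9) by (simp_all add: idempotent_2_cocycles_inertial_def)
  have fixes_zero: "\<sigma> \<zero>\<^bsub>L\<^esub> = \<zero>\<^bsub>L\<^esub>" and fixes_one: "\<sigma> \<one>\<^bsub>L\<^esub> = \<one>\<^bsub>L\<^esub>" if "\<sigma> \<in> carrier G" for \<sigma>
    using that assms(1) L.ring_axioms galois_group_fixes_zero_one by metis+
  interpret E: idempotent_cocycle G L "\<lambda>\<sigma>. \<sigma>" e
    by unfold_locales (use e fixes_zero fixes_one in auto)
  have "N \<noteq> {}"
    using subgroup.one_closed[OF N.is_subgroup] by blast
  \<comment> \<open>Nonempty cosets of automorphisms have a unique common value at 0 and at 1, which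
    gives the two conditions on \<open>coset_action\<close> required for the descent.\<close>
  then have C: "C \<noteq> {}" "C \<subseteq> carrier G" if "C \<in> carrier (G Mod N)" for C
    using that N.subset by (auto simp: FactGroup_def RCOSETS_def r_coset_def)
  have "\<exists>\<epsilon> \<in> idempotent_2_cocycles (G Mod N) coset_action (L\<lparr>carrier := fixed_field L N\<rparr>).
      e = inflation G N \<epsilon>" if "N \<subseteq> H"
  proof (rule E.descends_to_quotient)
    show "N \<subseteq> inertial_group G L e"
      using that H by simp
    show "\<zero>\<^bsub>L\<^esub> \<in> fixed_field L N" "\<one>\<^bsub>L\<^esub> \<in> fixed_field L N"
      using fixes_zero fixes_one N.subset by (auto simp: fixed_field_def)
    show "coset_action C \<zero>\<^bsub>L\<^esub> = \<zero>\<^bsub>L\<^esub>" "coset_action C \<one>\<^bsub>L\<^esub> = \<one>\<^bsub>L\<^esub>" if "C \<in> carrier (G Mod N)" for C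
      using C[OF that] fixes_zero fixes_one by (auto intro!: coset_action_eqI)
  qed (rule assms)
  moreover have "N \<subseteq> H" if "\<epsilon> \<in> idempotent_2_cocycles (G Mod N) coset_action
      (L\<lparr>carrier := fixed_field L N\<rparr>)" "e = inflation G N \<epsilon>" for \<epsilon>
    using normal_subset_inertial_group_inflation[OF assms(8) L.one_not_zero that(1)] that(2) H by simp
  ultimately show ?thesis
    \<comment> \<open>If \<open>e\<close> is the inflation of \<epsilon>, the inertial group of that
      inflation is \<open>H\<close>, which yields the second equality of quotients.\<close>
    using inertial_group_inflation[OF assms(8)] H by blast
qed

end
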